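(* Let $c_L,c_{L,I},h,h_I\in\mathbb{C}$ with $c_{L,I}\neq 0$ and assume that $p=\frac{h_I}{c_{L,I}}-1\in\mathbb{Z}_{>0}$. Then $$S_p\left(-\frac{I(-1)}{c_{L,I}},-\frac{I(-2)}{c_{L,I}},\dots\right)v_{h,h_I}$$ is a singular vector of conformal weight $p$ (i.e. lying in the $L(0)$-eigenspace of eigenvalue $h+p$) in the Verma module $V^{\mathcal H}(c_L,0,c_{L,I},h,h_I)$.
   Context: The twisted Heisenberg-Virasoro algebra $\mathcal H$ is the complex Lie algebra with basis $\{L(n),I(n):n\in\mathbb{Z}\}\cup\{C_L,C_{LI},C_I\}$ and brackets $[L(n),L(m)]=(n-m)L(n+m)+\delta_{n,-m}\frac{n^3-n}{12}C_L$, $[L(n),I(m)]=-mI(n+m)-\delta_{n,-m}(n^2+n)C_{LI}$, $[I(n),I(m)]=n\delta_{n,-m}C_I$, with $C_L,C_{LI},C_I$ central. $V^{\mathcal H}(c_L,0,c_{L,I},h,h_I)$ is the Verma module with highest weight vector $v_{h,h_I}$: $L(n)v_{h,h_I}=I(n)v_{h,h_I}=0$ for $n>0$, $L(0)v_{h,h_I}=hv_{h,h_I}$, $I(0)v_{h,h_I}=h_Iv_{h,h_I}$, and $C_L,C_I,C_{LI}$ act as $c_L,0,c_{L,I}$; it is free of rank one over $U(\mathcal H_-)$, $\mathcal H_-=\mathrm{span}\{L(-n),I(-n):n\ge1\}$. A singular vector is a nonzero vector annihilated by all $L(n),I(n)$, $n>0$, that is an eigenvector for $L(0)$ and $I(0)$.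 The Schur polynomials $S_r(x_1,x_2,\dots)$ are defined by $\exp\left(\sum_{n\ge1}\frac{x_n}{n}y^n\right)=\sum_{r\ge0}S_r(x_1,x_2,\dots)y^r$; $S_r$ involves only $x_1,\dots,x_r$. The operators $I(-1),I(-2),\dots$ commute. *)

theory Defs
  imports
    Complex_Main
    "HOL-Library.Poly_Mapping"
    "HOL-Computational_Algebra.Formal_Power_Series"
begin

section \<open>The twisted Heisenberg-Virasoro algebra\<close>

datatype hv_basis = Lb int | Ib int | CLb | CLIb | CIb

type_synonym hv = "hv_basis \<Rightarrow>\<^sub>0 complex"

definition cscale :: "complex \<Rightarrow> ('b \<Rightarrow>\<^sub>0 complex) \<Rightarrow> ('b \<Rightarrow>\<^sub>0 complex)" where
  "cscale c x = Poly_Mapping.map (\<lambda>t. c * t) x"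

abbreviation elt :: "hv_basis \<Rightarrow> hv" where
  "elt b \<equiv> Poly_Mapping.single b 1"

definition L :: "int \<Rightarrow> hv" where "L n = elt (Lb n)"
definition I :: "int \<Rightarrow> hv" where "I n = elt (Ib n)"
definition C_L :: hv where "C_L = elt CLb"
definition C_LI :: hv where "C_LI = elt CLIb"
definition C_I :: hv where "C_I = elt CIb"

fun basis_bracket :: "hv_basis \<Rightarrow> hv_basis \<Rightarrow> hv" where
  "basis_bracket (Lb n) (Lb m) =
     cscale (of_int (n - m)) (L (n + m))
     + (if n = - m then cscale (of_int (n^3 - n) / 12) C_L else 0)"
| "basis_bracket (Lb n) (Ib m) =
     cscale (- of_int m) (I (n + m))
     - (if n = - m then cscale (of_int (n^2 + n)) C_LI else 0)"
| "basis_bracket (Ib m) (Lb n) =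
     - (cscale (- of_int m) (I (n + m))
        - (if n = - m then cscale (of_int (n^2 + n)) C_LI else 0))"
| "basis_bracket (Ib n) (Ib m) = (if n = - m then cscale (of_int n) C_I else 0)"
| "basis_bracket _ _ = 0"

definition bracket :: "hv \<Rightarrow> hv \<Rightarrow> hv" where
  "bracket x y =
     (\<Sum>a\<in>Poly_Mapping.keys x. \<Sum>b\<in>Poly_Mapping.keys y.
        cscale (Poly_Mapping.lookup x a * Poly_Mapping.lookup y b) (basis_bracket a b))"

text \<open>\<open>H_minus\<close> is the subalgebra of the triangular decomposition spanned by \<open>neg_basis\<close>.\<close>

definition neg_basis :: "hv_basis set" where
  "neg_basis = {Lb (- n) | n. n \<ge> 1} \<union> {Ib (- n) | n. n \<ge> 1}"

definition H_minus :: "hv set" where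
  "H_minus = {x. Poly_Mapping.keys x \<subseteq> neg_basis}"


section \<open>The enveloping algebra of \<open>H_minus\<close>\<close>

text \<open>
  With the free monoid on a set as monoid of exponents, \<open>Poly_Mapping\<close> multiplication is that of
  the free associative algebra, i.e. of the tensor algebra of the vector space on that basis.
\<close>

datatype 'b word = Word (letters: "'b list")

instantiation word :: (type) monoid_add
begin
definition zero_word :: "'a word" where "0 = Word []"
definition plus_word :: "'a word \<Rightarrow> 'a word \<Rightarrow> 'a word" where
  "u + w = Word (letters u @ letters w)"
instance by standard (simp_all add: zero_word_def plus_word_def)
end

type_synonym hv_tensor = "hv_basis word \<Rightarrow>\<^sub>0 complex"

definition tensor_incl :: "hv \<Rightarrow> hv_tensor" where
  "tensor_incl x =
     (\<Sum>a\<in>Poly_Mapping.keys x. Poly_Mapping.single (Word [a]) (Poly_Mapping.lookup x a))"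

definition T_minus :: "hv_tensor set" where
  "T_minus = {t. \<forall>w\<in>Poly_Mapping.keys t. set (letters w) \<subseteq> neg_basis}"

text \<open>
  The two-sided ideal of \<open>T_minus\<close> generated by the elements
  \<open>x \<otimes> y - y \<otimes> x - [x,y]\<close> with \<open>x, y\<close> in \<open>H_minus\<close>; thus
  \<open>U(H_minus) = T_minus / U_ideal\<close>.
\<close>

inductive_set U_ideal :: "hv_tensor set" where
  zero: "0 \<in> U_ideal"
| add: "s \<in> U_ideal \<Longrightarrow> t \<in> U_ideal \<Longrightarrow> s + t \<in> U_ideal"
| gen: "x \<in> H_minus \<Longrightarrow> y \<in> H_minus \<Longrightarrow> s \<in> T_minus \<Longrightarrow> t \<in> T_minus \<Longrightarrow>
    s * (tensor_incl x * tensor_incl y - tensor_incl y * tensor_incl x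
         - tensor_incl (bracket x y)) * t \<in> U_ideal"


section \<open>Modules, Verma modules and singular vectors\<close>

locale hv_module = vector_space scale
  for scale :: "complex \<Rightarrow> 'v::ab_group_add \<Rightarrow> 'v" +
  fixes act :: "hv \<Rightarrow> 'v \<Rightarrow> 'v"
  assumes act_add_right: "act x (u + w) = act x u + act x w"
    and act_scale_right: "act x (scale c u) = scale c (act x u)"
    and act_add_left: "act (x + y) u = act x u + act y u"
    and act_scale_left: "act (cscale c x) u = scale c (act x u)"
    and act_bracket: "act (bracket x y) u = act x (act y u) - act y (act x u)"

text \<open>The action extended to the tensor algebra: a word acts as the composite of its letters.\<close>

definition tensor_act ::
  "(complex \<Rightarrow> 'v::ab_group_add \<Rightarrow> 'v) \<Rightarrow> (hv \<Rightarrow> 'v \<Rightarrow> 'v) \<Rightarrow> hv_tensor \<Rightarrow> 'v \<Rightarrow> 'v" where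
  "tensor_act scale act t u =
     (\<Sum>w\<in>Poly_Mapping.keys t.
        scale (Poly_Mapping.lookup t w) (foldr (\<lambda>a. act (elt a)) (letters w) u))"

text \<open>
  A Verma module \<open>V(c\<^sub>L, c\<^sub>I, c\<^sub>L\<^sub>I, h, h\<^sub>I)\<close> with highest weight vector \<open>v\<close>.
  The last two assumptions say that \<open>t \<mapsto> t v\<close> is onto with kernel the ideal of
  relations, i.e. that it induces a bijection \<open>U(H_minus) \<rightarrow> V\<close>: the module is free of rank one
  over \<open>U(H_minus)\<close> with generator \<open>v\<close>.  A highest weight module with this property
  is isomorphic to the module induced from the one-dimensional module spanned by \<open>v\<close>, and it is
  determined by the parameters up to a unique isomorphism preserving \<open>v\<close>.
\<close>

locale verma_module = hv_module scale act
  for scale :: "complex \<Rightarrow> 'v::ab_group_add \<Rightarrow> 'v"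
    and act :: "hv \<Rightarrow> 'v \<Rightarrow> 'v" +
  fixes c\<^sub>L c\<^sub>I c\<^sub>L\<^sub>I h h\<^sub>I :: complex and v :: 'v
  assumes L_pos: "n > 0 \<Longrightarrow> act (L n) v = 0"
    and I_pos: "n > 0 \<Longrightarrow> act (I n) v = 0"
    and L_zero: "act (L 0) v = scale h v"
    and I_zero: "act (I 0) v = scale h\<^sub>I v"
    and C_L_act: "act C_L u = scale c\<^sub>L u"
    and C_I_act: "act C_I u = scale c\<^sub>I u"
    and C_LI_act: "act C_LI u = scale c\<^sub>L\<^sub>I u"
    and generates: "(\<lambda>t. tensor_act scale act t v) ` T_minus = UNIV"
    and free: "{t \<in> T_minus. tensor_act scale act t v = 0} = U_ideal"

definition singular_vector ::
  "(complex \<Rightarrow> 'v::ab_group_add \<Rightarrow> 'v) \<Rightarrow> (hv \<Rightarrow> 'v \<Rightarrow> 'v) \<Rightarrow> 'v \<Rightarrow> bool" where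
  "singular_vector scale act w \<longleftrightarrow>
     w \<noteq> 0 \<and> (\<forall>n>0. act (L n) w = 0 \<and> act (I n) w = 0) \<and>
     (\<exists>a. act (L 0) w = scale a w) \<and> (\<exists>b. act (I 0) w = scale b w)"


section \<open>Schur polynomials\<close>

text \<open>Polynomials in commuting variables \<open>x\<^sub>1, x\<^sub>2, \<dots>\<close>, with exponents \<open>nat \<Rightarrow>\<^sub>0 nat\<close>.\<close>

type_synonym cpoly = "(nat \<Rightarrow>\<^sub>0 nat) \<Rightarrow>\<^sub>0 complex"

definition pconst :: "complex \<Rightarrow> cpoly" where
  "pconst c = Poly_Mapping.single 0 c"

definition pvar :: "nat \<Rightarrow> cpoly" where
  "pvar n = Poly_Mapping.single (Poly_Mapping.single n 1) 1"

text \<open>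
  \<open>fps_exp\<close> needs a field of coefficients, so the exponential series over the polynomial ring
  is written out.
\<close>

definition schur :: "nat \<Rightarrow> cpoly" where
  "schur r = fps_nth
     (fps_compose (Abs_fps (\<lambda>k. pconst (1 / fact k)))
        (Abs_fps (\<lambda>n. if n = 0 then 0 else pconst (1 / of_nat n) * pvar n))) r"

text \<open>
  \<open>P(A\<^sub>1, A\<^sub>2, \<dots>) u\<close> for pairwise commuting linear operators \<open>A\<^sub>n\<close>; the
  factors of a monomial are composed in increasing order of the index.
\<close>

definition poly_ops ::
  "(complex \<Rightarrow> 'v::ab_group_add \<Rightarrow> 'v) \<Rightarrow> cpoly \<Rightarrow> (nat \<Rightarrow> 'v \<Rightarrow> 'v) \<Rightarrow> 'v \<Rightarrow> 'v" where
  "poly_ops scale P A u =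
     (\<Sum>m\<in>Poly_Mapping.keys P. scale (Poly_Mapping.lookup P m)
        (foldr (\<lambda>n. A n ^^ Poly_Mapping.lookup m n)
           (sorted_list_of_set (Poly_Mapping.keys m)) u))"

end

(*
  The Schur polynomials satisfy r S_r = sum_j x_j S_{r-j}, so the vectors w_r = S_r v obey a
  recursion on which every operator can be evaluated by induction on r.  Since I(0) is central
  and C_I acts as 0, [L(m), -] shifts I(-k) to I(m-k), and one finds L(m) w_r = (r - p) w_{r-m}
  for m > 0, which vanishes at r = p.  That w_p is nonzero is detected by a character of the
  enveloping algebra of H_minus, so no PBW theorem is needed.
*)

theory Submission
  imports Defs
begin

section \<open>Linear extensions\<close>

text \<open>Inserting a fresh key amounts to adding a \<open>single\<close>, so an identity additive
  in \<open>f\<close> need only be checked on single terms.\<close>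

lemma poly_mapping_single_induct [case_names zero single add]:
  assumes "P 0" "\<And>k c. P (Poly_Mapping.single k c)"
    and "\<And>f g. P f \<Longrightarrow> P g \<Longrightarrow> P (f + g)"
  shows "P (f :: 'a \<Rightarrow>\<^sub>0 'b::monoid_add)"
proof (induction f rule: update_induct)
  case const
  show ?case by fact
next
  case (update f a b)
  have "Poly_Mapping.update a b f = f + Poly_Mapping.single a b"
    using update(1)
    by (intro poly_mapping_eqI)
      (auto simp: lookup_update lookup_add lookup_single when_def in_keys_iff)
  then show ?case
    using update.IH assms(2,3) by simp
qed

lemma lookup_cscale [simp]:
  "Poly_Mapping.lookup (cscale c x) k = c * Poly_Mapping.lookup x k"
  by (simp add: cscale_def Poly_Mapping.map.rep_eq when_def)

lemma cscale_simps [simp]: "cscale 0 x = 0" "cscale 1 x = x" "cscale c 0 = 0"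
  by (auto intro!: poly_mapping_eqI)

section \<open>The Newton recursion for Schur polynomials\<close>

lemma schur_0: "schur 0 = 1"
  by (simp add: schur_def pconst_def)

lemma pconst_mult: "pconst a * pconst b = pconst (a * b)"
  by (simp add: pconst_def mult_single)

lemma of_nat_eq_pconst: "of_nat n = pconst (of_nat n)"
  by (simp add: pconst_def)

text \<open>With F = exp(X), compare coefficients of y^r in F' = F X'. The factor 1/n in X cancels
  on differentiation, so X' has the bare variables as coefficients.\<close>

lemma schur_Suc:
  "of_nat (Suc r) * schur (Suc r) = (\<Sum>i\<le>r. pvar (Suc r - i) * schur i)"
proof -
  define E where "E = Abs_fps (\<lambda>k. pconst (1 / fact k))"
  define X where "X = Abs_fps (\<lambda>n. if n = 0 then 0 else pconst (1 / of_nat n) * pvar n)"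
  have schur: "schur n = fps_nth (E oo X) n" for n
    by (simp add: schur_def E_def X_def)
  have "fps_deriv E = E"
    unfolding E_def
    by (rule fps_ext)
      (simp add: of_nat_eq_pconst pconst_mult field_simps del: of_nat_Suc)
  \<comment> \<open>The chain rule for \<open>oo\<close> asks for a zero constant term, which
    \<open>X\<close> has.\<close>
  then have "fps_deriv (E oo X) = (E oo X) * fps_deriv X"
    by (subst fps_compose_deriv) (simp_all add: X_def)
  then have "fps_nth (fps_deriv (E oo X)) r = fps_nth ((E oo X) * fps_deriv X) r"
    by simp
  moreover have "fps_nth (fps_deriv X) n = pvar (Suc n)" for n
  proof -
    have "fps_nth (fps_deriv X) n = pconst (of_nat (Suc n)) * pconst (1 / of_nat (Suc n)) * pvar (Suc n)"
      by (simp add: X_def of_nat_eq_pconst mult.assoc del: of_nat_Suc)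
    also have "\<dots> = pvar (Suc n)"
      by (simp add: pconst_mult del: of_nat_Suc) (simp add: pconst_def)
    finally show ?thesis .
  qed
  ultimately have "of_nat (Suc r) * schur (Suc r) = (\<Sum>i=0..r. schur i * pvar (Suc (r - i)))"
    by (simp add: fps_mult_nth schur del: of_nat_Suc)
  also have "\<dots> = (\<Sum>i\<le>r. pvar (Suc r - i) * schur i)"
    by (intro sum.cong) (auto simp: mult.commute Suc_diff_le)
  finally show ?thesis .
qed

section \<open>Polynomials in commuting operators\<close>

locale commuting_operators = vector_space scale
  for scale :: "complex \<Rightarrow> 'v::ab_group_add \<Rightarrow> 'v" +
  fixes A :: "nat \<Rightarrow> 'v \<Rightarrow> 'v"
  assumes A_add: "A n (u + w) = A n u + A n w"
    and A_scale: "A n (scale c u) = scale c (A n u)"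
    and A_commute: "A m (A n u) = A n (A m u)"
begin

definition monom_op :: "(nat \<Rightarrow>\<^sub>0 nat) \<Rightarrow> 'v \<Rightarrow> 'v" where
  "monom_op m = foldr (\<lambda>n. A n ^^ Poly_Mapping.lookup m n)
     (sorted_list_of_set (Poly_Mapping.keys m))"

lemma A_zero: "A n 0 = 0"
  using A_scale[of n 0 0] by simp

lemma A_funpow_commute: "A m ((A n ^^ k) u) = (A n ^^ k) (A m u)"
  by (induction k) (simp_all add: A_commute[of m n])

text \<open>Indices of exponent 0 contribute the identity. This allows monomials with different
  supports to be compared over one index list.\<close>

lemma monom_op_superset:
  assumes "finite S" "Poly_Mapping.keys m \<subseteq> S"
  shows "monom_op m = foldr (\<lambda>n. A n ^^ Poly_Mapping.lookup m n) (sorted_list_of_set S)"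
proof -
  have "Poly_Mapping.keys m =
      set (filter (\<lambda>n. Poly_Mapping.lookup m n \<noteq> 0) (sorted_list_of_set S))"
    using assms by (auto simp: in_keys_iff)
  then have "sorted_list_of_set (Poly_Mapping.keys m) =
      filter (\<lambda>n. Poly_Mapping.lookup m n \<noteq> 0) (sorted_list_of_set S)"
    by (simp only:) (rule sorted_list_of_set.idem_if_sorted_distinct, simp_all add: sorted_wrt_filter)
  moreover have "foldr (\<lambda>n. A n ^^ f n) (filter (\<lambda>n. f n \<noteq> 0) xs) = foldr (\<lambda>n. A n ^^ f n) xs"
    for f xs by (induction xs) auto
  ultimately show ?thesis
    by (simp add: monom_op_def)
qed

text \<open>The extra factor \<open>A j\<close> commutes to the front past the powers on its left;
  distinctness ensures that only one factor gains an exponent.\<close>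

lemma foldr_Suc_exponent:
  assumes "distinct xs" "j \<in> set xs"
  shows "foldr (\<lambda>n. A n ^^ (if n = j then Suc (f n) else f n)) xs u =
    A j (foldr (\<lambda>n. A n ^^ f n) xs u)"
  using assms
proof (induction xs)
  case (Cons x xs)
  show ?case
  proof (cases "x = j")
    case True
    with Cons.prems have "foldr (\<lambda>n. A n ^^ (if n = j then Suc (f n) else f n)) xs u =
        foldr (\<lambda>n. A n ^^ f n) xs u"
      by (intro foldr_cong) auto
    with True show ?thesis by simp
  next
    case False
    with Cons show ?thesis by (simp add: A_funpow_commute)
  qed
qed simp

lemma monom_op_single_add: "monom_op (Poly_Mapping.single j 1 + m) u = A j (monom_op m u)"
proof -
  define S where "S = insert j (Poly_Mapping.keys m)"
  have "Poly_Mapping.keys (Poly_Mapping.single j 1 + m) \<subseteq> S"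
    using keys_add[of "Poly_Mapping.single j 1" m] by (auto simp: S_def)
  then have "monom_op (Poly_Mapping.single j 1 + m) =
      foldr (\<lambda>n. A n ^^ (if n = j then Suc (Poly_Mapping.lookup m n) else Poly_Mapping.lookup m n))
        (sorted_list_of_set S)"
    by (subst monom_op_superset[of S])
      (auto simp: S_def lookup_add lookup_single when_def intro!: arg_cong[where f = "\<lambda>g. foldr g _"])
  moreover have "monom_op m = foldr (\<lambda>n. A n ^^ Poly_Mapping.lookup m n) (sorted_list_of_set S)"
    by (rule monom_op_superset) (auto simp: S_def)
  moreover have "j \<in> set (sorted_list_of_set S)"
    by (simp add: S_def set_insort_key)
  ultimately show ?thesis
    by (simp add: foldr_Suc_exponent)
qed

lemma poly_ops_eq:
  "poly_ops scale P A u =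
    (\<Sum>m\<in>Poly_Mapping.keys P. scale (Poly_Mapping.lookup P m) (monom_op m u))"
  by (simp add: poly_ops_def monom_op_def)

lemma poly_ops_add: "poly_ops scale (P + Q) A u = poly_ops scale P A u + poly_ops scale Q A u"
  unfolding poly_ops_eq by (rule setsum_keys_plus_distrib) (simp_all add: scale_left_distrib)

lemma poly_ops_single: "poly_ops scale (Poly_Mapping.single m c) A u = scale c (monom_op m u)"
  by (simp add: poly_ops_eq)

lemma poly_ops_zero: "poly_ops scale 0 A u = 0"
  by (simp add: poly_ops_eq)

lemma poly_ops_one: "poly_ops scale 1 A u = u"
  using poly_ops_single[of 0 1 u] by (simp add: monom_op_def)

lemma poly_ops_sum: "poly_ops scale (sum P S) A u = (\<Sum>i\<in>S. poly_ops scale (P i) A u)"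
  by (induction S rule: infinite_finite_induct) (simp_all add: poly_ops_add poly_ops_zero)

text \<open>The Newton recursion multiplies polynomials only by variables and constants, so this and
  \<open>poly_ops_pconst_mult\<close> are the multiplicativity required to carry it over to
  vectors.\<close>

lemma poly_ops_pvar_mult: "poly_ops scale (pvar j * P) A u = A j (poly_ops scale P A u)"
  by (induction P rule: poly_mapping_single_induct)
    (simp_all add: poly_ops_zero A_zero pvar_def mult_single poly_ops_single A_scale
      monom_op_single_add distrib_left poly_ops_add A_add del: One_nat_def)

lemma poly_ops_pconst_mult: "poly_ops scale (pconst c * P) A u = scale c (poly_ops scale P A u)"
  by (induction P rule: poly_mapping_single_induct)
    (simp_all add: poly_ops_zero pconst_def mult_single poly_ops_single
      distrib_left poly_ops_add scale_right_distrib)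

lemma poly_ops_schur_Suc:
  "poly_ops scale (schur (Suc r)) A u =
    scale (1 / of_nat (Suc r)) (\<Sum>i<Suc r. A (Suc r - i) (poly_ops scale (schur i) A u))"
proof -
  have "scale (of_nat (Suc r)) (poly_ops scale (schur (Suc r)) A u) =
      (\<Sum>i<Suc r. A (Suc r - i) (poly_ops scale (schur i) A u))"
    using arg_cong[OF schur_Suc[of r], of "\<lambda>P. poly_ops scale P A u"]
    by (simp add: of_nat_eq_pconst poly_ops_pconst_mult poly_ops_sum poly_ops_pvar_mult
        lessThan_Suc_atMost del: of_nat_Suc sum.lessThan_Suc)
  from arg_cong[OF this, of "scale (1 / of_nat (Suc r))"] show ?thesis
    by (simp del: of_nat_Suc sum.lessThan_Suc)
qed

end

section \<open>A character of the enveloping algebra\<close>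

text \<open>
  \<open>Ib (-1)\<close> does not occur in any bracket of \<open>H_minus\<close>, so sending it to 1 and all other basis
  elements to 0 defines a one-dimensional representation.
\<close>

definition chi :: "hv_tensor \<Rightarrow> complex" where
  "chi t = (\<Sum>w\<in>Poly_Mapping.keys t.
     Poly_Mapping.lookup t w * prod_list (map (\<lambda>a. if a = Ib (-1) then 1 else 0) (letters w)))"

lemma chi_add: "chi (s + t) = chi s + chi t"
  unfolding chi_def by (rule setsum_keys_plus_distrib) (simp_all add: algebra_simps)

lemma chi_zero [simp]: "chi 0 = 0"
  by (simp add: chi_def)

lemma chi_diff: "chi (s - t) = chi s - chi t"
  using chi_add[of "s - t" t] by simp

lemma chi_sum: "chi (sum f S) = (\<Sum>i\<in>S. chi (f i))"
  by (induction S rule: infinite_finite_induct) (simp_all add: chi_add)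

lemma chi_single:
  "chi (Poly_Mapping.single w c) =
    c * prod_list (map (\<lambda>a. if a = Ib (-1) then 1 else 0) (letters w))"
  by (simp add: chi_def)

text \<open>The product over the letters turns concatenation of words into multiplication, and both
  sides are bilinear.\<close>

lemma chi_mult: "chi (s * t) = chi s * chi t"
proof (induction s rule: poly_mapping_single_induct)
  case (single k c)
  show ?case
    by (induction t rule: poly_mapping_single_induct)
      (simp_all add: mult_single chi_single plus_word_def distrib_left chi_add)
qed (simp_all add: distrib_right chi_add)

lemma chi_tensor_incl: "chi (tensor_incl x) = Poly_Mapping.lookup x (Ib (-1))"
proof -
  have "chi (tensor_incl x) =
      (\<Sum>a\<in>Poly_Mapping.keys x. if a = Ib (-1) then Poly_Mapping.lookup x a else 0)"
    unfolding tensor_incl_def chi_sum by (intro sum.cong) (auto simp: chi_single)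
  then show ?thesis
    by (simp add: in_keys_iff)
qed

text \<open>Indices add under the bracket, and two indices of at most -1 have sum at most
  -2.\<close>

lemma lookup_basis_bracket_neg:
  assumes "a \<in> neg_basis" "b \<in> neg_basis"
  shows "Poly_Mapping.lookup (basis_bracket a b) (Ib (-1)) = 0"
  using assms
  by (auto simp: neg_basis_def lookup_minus lookup_add L_def I_def C_L_def C_LI_def C_I_def
      lookup_single when_def)

text \<open>The values of \<open>chi\<close> commute, so it kills x y - y x; it kills the bracket
  because no \<open>Ib (-1)\<close> occurs there.\<close>

lemma chi_U_ideal:
  assumes "t \<in> U_ideal"
  shows "chi t = 0"
  using assms
proof induction
  case (gen x y s t)
  have "chi (tensor_incl (bracket x y)) = 0"
    using gen
    by (auto simp: chi_tensor_incl bracket_def lookup_sum H_minus_def subset_iff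
        lookup_basis_bracket_neg intro!: sum.neutral)
  then show ?case
    by (simp add: chi_mult chi_diff)
qed (simp_all add: chi_add)

section \<open>Commutation relations\<close>

lemma bracket_elt: "bracket (elt a) (elt b) = basis_bracket a b"
  by (simp add: bracket_def)

context hv_module
begin

lemma act_zero_right: "act x 0 = 0"
  using act_scale_right[of x 0 0] by simp

lemma act_zero_left: "act 0 u = 0"
  using act_scale_left[of 0 0 u] by simp

lemma act_minus_right: "act x (- u) = - act x u"
  using act_add_right[of x u "- u"] by (simp add: act_zero_right eq_neg_iff_add_eq_0 add.commute)

lemma act_diff_left: "act (x - y) u = act x u - act y u"
  using act_add_left[of "x - y" y u] by simp

lemma act_sum_right: "act x (sum f S) = (\<Sum>i\<in>S. act x (f i))"
  by (induction S rule: infinite_finite_induct) (simp_all add: act_add_right act_zero_right)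

text \<open>The defining bracket as a rule carrying \<open>L m\<close> to the right past
  \<open>I k\<close>. The central element stays an operator, since its scalar is fixed only in a
  Verma module.\<close>

lemma act_L_I:
  "act (L m) (act (I k) u) = act (I k) (act (L m) u) - scale (of_int k) (act (I (m + k)) u)
    - (if m = - k then scale (of_int (m^2 + m)) (act C_LI u) else 0)"
proof -
  have "act (bracket (L m) (I k)) u = - scale (of_int k) (act (I (m + k)) u)
      - (if m = - k then scale (of_int (m^2 + m)) (act C_LI u) else 0)"
    unfolding L_def I_def bracket_elt
    by (simp add: act_diff_left act_scale_left act_zero_left I_def)
  then show ?thesis
    by (simp add: act_bracket algebra_simps split: if_splits)
qed

lemma act_I_I:
  "act (I m) (act (I k) u) = act (I k) (act (I m) u)
    + (if m = - k then scale (of_int m) (act C_I u) else 0)"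
proof -
  have "act (bracket (I m) (I k)) u = (if m = - k then scale (of_int m) (act C_I u) else 0)"
    unfolding I_def bracket_elt
    by (simp add: act_scale_left act_zero_left)
  then show ?thesis
    by (simp add: act_bracket algebra_simps split: if_splits)
qed

lemma tensor_act_add:
  "tensor_act scale act (s + t) u = tensor_act scale act s u + tensor_act scale act t u"
  unfolding tensor_act_def by (rule setsum_keys_plus_distrib) (simp_all add: scale_left_distrib)

lemma tensor_act_single:
  "tensor_act scale act (Poly_Mapping.single w c) u =
    scale c (foldr (\<lambda>a. act (elt a)) (letters w) u)"
  by (simp add: tensor_act_def)

lemma tensor_act_zero: "tensor_act scale act 0 u = 0"
  by (simp add: tensor_act_def)

lemma tensor_act_sum: "tensor_act scale act (sum f S) u = (\<Sum>i\<in>S. tensor_act scale act (f i) u)"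
  by (induction S rule: infinite_finite_induct) (simp_all add: tensor_act_add tensor_act_zero)

lemma tensor_act_letter_mult:
  "tensor_act scale act (Poly_Mapping.single (Word [a]) c * t) u =
    scale c (act (elt a) (tensor_act scale act t u))"
  by (induction t rule: poly_mapping_single_induct)
    (simp_all add: tensor_act_zero act_zero_right mult_single tensor_act_single plus_word_def
      act_scale_right distrib_left tensor_act_add act_add_right scale_right_distrib)

end

section \<open>Closure properties of the tensor algebra of \<open>H_minus\<close>\<close>

lemma T_minus_zero: "0 \<in> T_minus"
  by (simp add: T_minus_def)

lemma T_minus_one: "1 \<in> T_minus"
  by (simp add: T_minus_def zero_word_def)

lemma T_minus_add: "s \<in> T_minus \<Longrightarrow> t \<in> T_minus \<Longrightarrow> s + t \<in> T_minus"
  using keys_add[of s t] by (fastforce simp: T_minus_def)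

lemma T_minus_sum: "(\<And>i. i \<in> S \<Longrightarrow> f i \<in> T_minus) \<Longrightarrow> sum f S \<in> T_minus"
  by (induction S rule: infinite_finite_induct) (simp_all add: T_minus_add T_minus_zero)

lemma T_minus_letter_mult:
  assumes "a \<in> neg_basis" "t \<in> T_minus"
  shows "Poly_Mapping.single (Word [a]) c * t \<in> T_minus"
  using keys_mult[of "Poly_Mapping.single (Word [a]) c" t] assms
  by (fastforce simp: T_minus_def plus_word_def split: if_splits)

section \<open>The singular vector\<close>

locale verma_level_zero = verma_module scale act c\<^sub>L 0 c\<^sub>L\<^sub>I h h\<^sub>I v
  for scale :: "complex \<Rightarrow> 'v::ab_group_add \<Rightarrow> 'v"
    and act :: "hv \<Rightarrow> 'v \<Rightarrow> 'v"
    and c\<^sub>L c\<^sub>L\<^sub>I h h\<^sub>I :: complex and v :: 'v +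
  assumes c\<^sub>L\<^sub>I_nonzero: "c\<^sub>L\<^sub>I \<noteq> 0"
begin

section \<open>The vectors \<open>W r\<close> and their recursion\<close>

definition A :: "nat \<Rightarrow> 'v \<Rightarrow> 'v" where
  "A n u = scale (- 1 / c\<^sub>L\<^sub>I) (act (I (- int n)) u)"

text \<open>\<open>C_I\<close> acts as 0, so all modes commute, not only the negative ones. Hence
  \<open>I n\<close> passes through every \<open>A k\<close>.\<close>

lemma act_I_commute: "act (I m) (act (I k) u) = act (I k) (act (I m) u)"
  by (subst act_I_I) (simp add: C_I_act)

sublocale commuting_operators scale A
proof
  show "A m (A n u) = A n (A m u)" for m n u
    unfolding A_def act_scale_right by (subst act_I_commute) (rule refl)
  show "A n (u + w) = A n u + A n w" for n u w
    unfolding A_def by (simp only: act_add_right scale_right_distrib)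
  show "A n (scale c u) = scale c (A n u)" for n c u
    unfolding A_def by (simp only: act_scale_right scale_left_commute)
qed

definition W :: "nat \<Rightarrow> 'v" where
  "W r = poly_ops scale (schur r) A v"

lemma W_0: "W 0 = v"
  by (simp add: W_def schur_0 poly_ops_one)

lemma W_Suc: "W (Suc r) = scale (1 / of_nat (Suc r)) (\<Sum>i<Suc r. A (Suc r - i) (W i))"
  unfolding W_def by (rule poly_ops_schur_Suc)

section \<open>Action of the modes on the vectors \<open>W r\<close>\<close>

lemma act_I_A: "act (I n) (A k u) = A k (act (I n) u)"
  unfolding A_def act_scale_right by (subst act_I_commute) (rule refl)

text \<open>The factor -1/\<open>c\<^sub>L\<^sub>I\<close> in \<open>A\<close> turns the central
  term of the bracket into the plain scalar m^2 + m.\<close>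

lemma act_L_A:
  "act (L (int m)) (A k u) = A k (act (L (int m)) u)
    + scale (- of_nat k / c\<^sub>L\<^sub>I) (act (I (int m - int k)) u)
    + (if m = k then scale (of_nat (m^2 + m)) u else 0)"
  using c\<^sub>L\<^sub>I_nonzero
  by (simp add: A_def act_scale_right act_minus_right act_L_I C_LI_act scale_right_diff_distrib
      scale_right_distrib)

lemma act_I_W: "act (I n) v = scale a v \<Longrightarrow> act (I n) (W r) = scale a (W r)"
proof (induction r rule: less_induct)
  case (less r)
  show ?case
  proof (cases r)
    case 0
    with less.prems show ?thesis by (simp add: W_0)
  next
    case (Suc q)
    have "(\<Sum>i<r. A (r - i) (act (I n) (W i))) = scale a (\<Sum>i<r. A (r - i) (W i))"
      unfolding scale_sum_right using less by (intro sum.cong) (auto simp: A_scale)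
    with Suc show ?thesis
      by (simp add: W_Suc act_scale_right act_sum_right act_I_A mult.commute
          del: sum.lessThan_Suc of_nat_Suc)
  qed
qed

lemma act_I_pos_W: "n > 0 \<Longrightarrow> act (I n) (W r) = 0"
  using act_I_W[of n 0 r] I_pos by simp

lemma act_I_zero_W: "act (I 0) (W r) = scale h\<^sub>I (W r)"
  by (rule act_I_W) (rule I_zero)

text \<open>The commutator produces the mode m - k. If negative, it is again some \<open>A\<close>;
  if zero, it acts by \<open>h\<^sub>I\<close> and merges with the central scalar; if positive, it
  kills \<open>W r\<close>.\<close>

lemma act_L_A_W:
  "act (L (int m)) (A k (W r)) = A k (act (L (int m)) (W r)) +
    (if m < k then scale (of_nat k) (A (k - m) (W r))
     else if m = k then scale (of_nat m * (of_nat m + 1 - h\<^sub>I / c\<^sub>L\<^sub>I)) (W r) else 0)"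
proof -
  consider "m < k" | "m = k" | "k < m" by linarith
  then show ?thesis
  proof cases
    case 1
    then have "int m - int k = - int (k - m)" by simp
    with 1 show ?thesis by (simp only: act_L_A) (simp add: A_def)
  next
    case 2
    then show ?thesis
      by (simp add: act_L_A act_I_zero_W flip: scale_left_distrib)
        (simp add: algebra_simps power2_eq_square)
  next
    case 3
    then show ?thesis by (simp add: act_L_A act_I_pos_W)
  qed
qed

lemma act_L_zero_W: "act (L 0) (W r) = scale (h + of_nat r) (W r)"
proof (induction r rule: less_induct)
  case (less r)
  show ?case
  proof (cases r)
    case 0
    then show ?thesis by (simp add: W_0 L_zero)
  next
    case (Suc q)
    have "(\<Sum>i<r. act (L 0) (A (r - i) (W i))) = scale (h + of_nat r) (\<Sum>i<r. A (r - i) (W i))"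
      unfolding scale_sum_right
    proof (intro sum.cong refl)
      fix i assume "i \<in> {..<r}"
      then show "act (L 0) (A (r - i) (W i)) = scale (h + of_nat r) (A (r - i) (W i))"
        \<comment> \<open>Here 0 < r - i, so the first case applies with shift 0 and adds r - i to
          the eigenvalue h + i.\<close>
        using act_L_A_W[of 0 "r - i" i] less
        by (simp add: A_scale of_nat_diff flip: scale_left_distrib)
    qed
    with Suc show ?thesis
      by (simp add: W_Suc act_scale_right act_sum_right mult.commute
          del: sum.lessThan_Suc of_nat_Suc)
  qed
qed

text \<open>Apply \<open>L m\<close> to the recursion for r \<open>W r\<close>. The induction
  hypothesis and the commutators give sums that recombine through the recursion at r - m; the
  assumption on \<open>h\<^sub>I\<close> makes the boundary scalar m (m - p).\<close>

lemma act_L_pos_W: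
  assumes "m > 0" "h\<^sub>I / c\<^sub>L\<^sub>I = of_nat p + 1"
  shows "act (L (int m)) (W r) =
    (if m \<le> r then scale (of_nat r - of_nat p) (W (r - m)) else 0)"
proof (induction r rule: less_induct)
  case (less r)
  have LW: "A k (act (L (int m)) (W i)) =
      (if m \<le> i then scale (of_nat i - of_nat p) (A k (W (i - m))) else 0)" if "i < r" for i k
    using less.IH[OF that] by (simp add: A_scale A_zero)
  show ?case
  proof (cases r)
    case 0
    with assms show ?thesis by (simp add: W_0 L_pos)
  next
    case (Suc q')
    define S where "S = (\<Sum>i<r. act (L (int m)) (A (r - i) (W i)))"
    have LWr: "act (L (int m)) (W r) = scale (1 / of_nat r) S"
      using Suc by (simp add: S_def W_Suc act_scale_right act_sum_right
          del: sum.lessThan_Suc of_nat_Suc)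
    show ?thesis
    proof (cases "m \<le> r")
      case False
      then have "S = 0"
        unfolding S_def by (intro sum.neutral) (auto simp: act_L_A_W LW)
      with False LWr show ?thesis by simp
    next
      case True
      then obtain q where r: "r = q + m" by (metis le_add_diff_inverse2)
      define T where "T = (\<Sum>i<q. A (q - i) (W i))"
      have T: "T = scale (of_nat q) (W q)"
        by (cases q) (simp_all add: T_def W_Suc del: sum.lessThan_Suc of_nat_Suc)
      \<comment> \<open>\<open>f\<close> collects the terms where \<open>L m\<close> reaches
        \<open>W i\<close>, and \<open>g\<close> the commutators with
        \<open>A (r - i)\<close>.\<close>
      define f where "f i = (if m \<le> i then scale (of_nat i - of_nat p) (A (r - i) (W (i - m))) else 0)" for i
      define g where "g i =
        (if m < r - i then scale (of_nat (r - i)) (A (r - i - m) (W i))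
         else if m = r - i then scale (of_nat m * (of_nat m - of_nat p)) (W i) else 0)" for i
      have "S = (\<Sum>i<r. f i) + (\<Sum>i<r. g i)"
        unfolding S_def sum.distrib[symmetric] f_def g_def
        by (intro sum.cong) (auto simp: act_L_A_W LW assms(2))
      also have "(\<Sum>i<r. f i) = (\<Sum>i\<in>{m..<q+m}. f i)"
        by (rule sum.mono_neutral_right) (auto simp: f_def r)
      also have "\<dots> = (\<Sum>i<q. f (i + m))"
        using sum.shift_bounds_nat_ivl[of f 0 m q] by (simp add: atLeast0LessThan)
      \<comment> \<open>Beyond i = q the mode is positive and contributes nothing; i = q itself is
        the \<open>I 0\<close> case, split off next. Since m > 0, q is below r.\<close>
      also have "(\<Sum>i<r. g i) = (\<Sum>i<Suc q. g i)"
        using assms(1) by (intro sum.mono_neutral_right) (auto simp: g_def r)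
      also have "\<dots> = (\<Sum>i<q. g i) + scale (of_nat m * (of_nat m - of_nat p)) (W q)"
        by (simp add: g_def r)
      also have "(\<Sum>i<q. f (i + m)) + ((\<Sum>i<q. g i) + scale (of_nat m * (of_nat m - of_nat p)) (W q)) =
          (\<Sum>i<q. f (i + m) + g i) + scale (of_nat m * (of_nat m - of_nat p)) (W q)"
        by (simp add: sum.distrib)
      \<comment> \<open>The coefficients i + m - p and r - i add up to a value independent of i, so
        T factors out.\<close>
      also have "(\<Sum>i<q. f (i + m) + g i) = scale (of_nat r + of_nat m - of_nat p) T"
        unfolding T_def scale_sum_right
        by (intro sum.cong)
          (auto simp: f_def g_def r of_nat_diff algebra_simps simp flip: scale_left_distrib)
      \<comment> \<open>With q = r - m: (r + m - p) q + m (m - p) = r (r - p). The factor r cancels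
        the 1/r of the recursion.\<close>
      also have "scale (of_nat r + of_nat m - of_nat p) T
            + scale (of_nat m * (of_nat m - of_nat p)) (W q)
          = scale (of_nat r * (of_nat r - of_nat p)) (W q)"
        unfolding T r by (simp flip: scale_left_distrib) (simp add: algebra_simps)
      finally have "S = scale (of_nat r * (of_nat r - of_nat p)) (W q)" .
      moreover have "of_nat r \<noteq> (0 :: complex)"
        using Suc by (simp del: of_nat_Suc)
      ultimately have "act (L (int m)) (W r) = scale (of_nat r - of_nat p) (W q)"
        by (simp add: LWr)
      then show ?thesis
        by (simp add: r)
    qed
  qed
qed

section \<open>Nonvanishing of \<open>W r\<close>\<close>

text \<open>The recursion lifts to explicit tensors. Only the monomial x_1^r / r! of the Schur
  polynomial survives under \<open>chi\<close>, evaluated at x_1 =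
  -1/\<open>c\<^sub>L\<^sub>I\<close>.\<close>

lemma chi_W:
  "\<exists>t\<in>T_minus. tensor_act scale act t v = W r \<and> chi t = (- 1 / c\<^sub>L\<^sub>I) ^ r / fact r"
proof (induction r rule: less_induct)
  case (less r)
  show ?case
  proof (cases r)
    case 0
    have "tensor_act scale act 1 v = v" "chi 1 = 1"
      by (simp_all add: tensor_act_single chi_single zero_word_def flip: single_one)
    with 0 show ?thesis
      using T_minus_one by (auto simp: W_0)
  next
    case (Suc q)
    from less have "\<forall>i. \<exists>t. i < r \<longrightarrow> t \<in> T_minus \<and> tensor_act scale act t v = W i
        \<and> chi t = (- 1 / c\<^sub>L\<^sub>I) ^ i / fact i"
      by blast
    then obtain t where t: "\<And>i. i < r \<Longrightarrow> t i \<in> T_minus"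
      "\<And>i. i < r \<Longrightarrow> tensor_act scale act (t i) v = W i"
      "\<And>i. i < r \<Longrightarrow> chi (t i) = (- 1 / c\<^sub>L\<^sub>I) ^ i / fact i"
      unfolding choice_iff by blast
    \<comment> \<open>\<open>x i\<close> is the tensor acting as 1/r times
      \<open>A (r - i)\<close>.\<close>
    define x where "x i = Poly_Mapping.single (Word [Ib (- int (r - i))]) (1 / of_nat r * (- 1 / c\<^sub>L\<^sub>I))" for i
    define u where "u = (\<Sum>i<r. x i * t i)"
    have "u \<in> T_minus"
      unfolding u_def x_def by (intro T_minus_sum T_minus_letter_mult t) 
        (auto simp: neg_basis_def intro!: exI[of _ "int r - int _"])
    moreover have "tensor_act scale act u v = W r"
    proof -
      have "tensor_act scale act u v = (\<Sum>i<r. scale (1 / of_nat r) (A (r - i) (W i)))"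
        unfolding u_def tensor_act_sum x_def tensor_act_letter_mult
        by (intro sum.cong) (simp_all add: t A_def I_def)
      then show ?thesis
        using Suc by (simp add: W_Suc scale_sum_right del: sum.lessThan_Suc of_nat_Suc)
    qed
    moreover have "chi u = (- 1 / c\<^sub>L\<^sub>I) ^ r / fact r"
    proof -
      \<comment> \<open>The letter is \<open>Ib (-1)\<close> exactly when r - i = 1.\<close>
      have "chi (x i) = (if i = q then 1 / of_nat r * (- 1 / c\<^sub>L\<^sub>I) else 0)" if "i < r" for i
        using that Suc by (auto simp: x_def chi_single)
      then have "chi u = (\<Sum>i<r. if i = q then 1 / of_nat r * (- 1 / c\<^sub>L\<^sub>I) * chi (t q) else 0)"
        unfolding u_def chi_sum chi_mult by (intro sum.cong) auto
      then show ?thesis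
        using Suc t(3)[of q] by (simp add: fact_Suc field_simps del: of_nat_Suc)
    qed
    ultimately show ?thesis by blast
  qed
qed

text \<open>If \<open>W r\<close> were 0, freeness would place its representing tensor in
  \<open>U_ideal\<close>, where \<open>chi\<close> vanishes; but its \<open>chi\<close> value is
  nonzero.\<close>

lemma W_nonzero: "W r \<noteq> 0"
proof
  assume "W r = 0"
  with chi_W[of r] obtain t where "t \<in> T_minus" "tensor_act scale act t v = 0"
    and t: "chi t = (- 1 / c\<^sub>L\<^sub>I) ^ r / fact r" by auto
  then have "t \<in> U_ideal" using free by auto
  with t chi_U_ideal[of t] c\<^sub>L\<^sub>I_nonzero show False by simp
qed

end

theorem theorem1p2:
  fixes scale :: "complex \<Rightarrow> 'v::ab_group_add \<Rightarrow> 'v"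
    and act :: "hv \<Rightarrow> 'v \<Rightarrow> 'v"
    and c\<^sub>L c\<^sub>L\<^sub>I h h\<^sub>I :: complex and v :: 'v and p :: nat
  assumes "verma_module scale act c\<^sub>L 0 c\<^sub>L\<^sub>I h h\<^sub>I v"
    and "c\<^sub>L\<^sub>I \<noteq> 0"
    and "p > 0" and "h\<^sub>I / c\<^sub>L\<^sub>I - 1 = of_nat p"
  shows "let w = poly_ops scale (schur p)
                 (\<lambda>n u. scale (- 1 / c\<^sub>L\<^sub>I) (act (I (- int n)) u)) v
         in singular_vector scale act w \<and> act (L 0) w = scale (h + of_nat p) w"
proof -
  interpret verma_level_zero scale act c\<^sub>L c\<^sub>L\<^sub>I h h\<^sub>I v
    by (intro verma_level_zero.intro verma_level_zero_axioms.intro assms(1,2))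
  have A_eq: "(\<lambda>n u. scale (- 1 / c\<^sub>L\<^sub>I) (act (I (- int n)) u)) = A"
    by (intro ext) (simp add: A_def)
  \<comment> \<open>At r = p the factor r - p is zero, so both branches of the formula
    vanish.\<close>
  have "act (L n) (W p) = 0" if "n > 0" for n
    using act_L_pos_W[of "nat n" p p] that assms(4) by (simp add: algebra_simps)
  then have "singular_vector scale act (W p)"
    unfolding singular_vector_def
    using W_nonzero act_I_pos_W act_L_zero_W act_I_zero_W by blast
  then show ?thesis
    unfolding A_eq Let_def W_def[symmetric] by (simp add: act_L_zero_W)
qed

end
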